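(* Let $n\ge 1$ and $t\ge r\ge 1$ be integers, and let $P_n$ be the path on $n$ vertices. Then \[\gamma_{t,r}(P_n)=\left\lceil \frac{n+(r-1)}{2t-r}\right\rceil .\]
   Context: For a connected graph $G$ with vertex set $V(G)$ and graph distance $d$, positive integers $t,r$, and a set $\mathbb T\subseteq V(G)$ (whose elements are called towers, of strength $t$), the signal received by $v\in V(G)$ is $f(v)=\sum_{w\in\mathbb T}\max\{0,\,t-d(v,w)\}$ (a tower also receives its own signal). The set $\mathbb T$ is a $(t,r)$ broadcast dominating set if $f(v)\ge r$ for every $v\in V(G)$. The $(t,r)$ broadcast domination number $\gamma_{t,r}(G)$ is the minimum cardinality of a $(t,r)$ broadcast dominating set of $G$. *)

theory Defs
  imports "Graph_Theory.Graph_Theory"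
begin

text \<open>Undirected simple graphs are the (symmetric, loop-free) digraphs of the locale
  \<open>graph\<close>: an edge is a pair of opposite arcs.\<close>

definition path_graph :: "nat \<Rightarrow> nat pair_pre_digraph" where
  "path_graph n = \<lparr> pverts = {0..<n},
     parcs = {(i, j). i < n \<and> j < n \<and> (j = Suc i \<or> i = Suc j)} \<rparr>"

text \<open>Shortest walks with unit arc weights. The value is \<open>\<infinity>\<close> between vertices
  in different components.\<close>

definition graph_dist :: "('a, 'b) pre_digraph \<Rightarrow> 'a \<Rightarrow> 'a \<Rightarrow> ereal" where
  "graph_dist G u v = wf_digraph.\<mu> G (\<lambda>_. 1) u v"

definition signal :: "('a, 'b) pre_digraph \<Rightarrow> nat \<Rightarrow> 'a set \<Rightarrow> 'a \<Rightarrow> ereal" where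
  "signal G t T v = (\<Sum>w\<in>T. max 0 (ereal (real t) - graph_dist G v w))"

definition broadcast_dominating ::
    "('a, 'b) pre_digraph \<Rightarrow> nat \<Rightarrow> nat \<Rightarrow> 'a set \<Rightarrow> bool" where
  "broadcast_dominating G t r T \<longleftrightarrow>
     T \<subseteq> verts G \<and> (\<forall>v\<in>verts G. ereal (real r) \<le> signal G t T v)"

text \<open>Intended for finite graphs. For \<open>t \<ge> r\<close> the set of all vertices is dominating,
  so the minimum is then attained.\<close>

definition broadcast_domination_number ::
    "('a, 'b) pre_digraph \<Rightarrow> nat \<Rightarrow> nat \<Rightarrow> nat" where
  "broadcast_domination_number G t r =
     (LEAST k. \<exists>T. broadcast_dominating G t r T \<and> card T = k)"

lemma verts_path_graph: "pverts (path_graph n) = {0..<n}"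
  by (simp add: path_graph_def)

lemma arcs_path_graph:
  "(i, j) \<in> parcs (path_graph n) \<longleftrightarrow> i < n \<and> j < n \<and> (j = Suc i \<or> i = Suc j)"
  by (simp add: path_graph_def)

lemma pair_graph_path_graph: "pair_graph (path_graph n)"
proof
  have "parcs (path_graph n) \<subseteq> {0..<n} \<times> {0..<n}"
    by (auto simp: path_graph_def)
  then show "finite (parcs (path_graph n))"
    by (rule finite_subset) simp
qed (auto simp: path_graph_def sym_def symmetric_def)

lemma connected_path_graph:
  assumes "n \<ge> 1"
  shows "connected (path_graph n)"
proof -
  interpret pair_graph "path_graph n" by (rule pair_graph_path_graph)
  have arc: "i \<rightarrow>\<^sup>*\<^bsub>path_graph n\<^esub> Suc i" if "Suc i < n" for i
    using that by (intro reachable_adjI) (auto simp: arcs_path_graph)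
  have fwd: "0 \<rightarrow>\<^sup>*\<^bsub>path_graph n\<^esub> i" if "i < n" for i
    using that
  proof (induction i)
    case 0
    then show ?case by (intro reachable_refl) (simp add: verts_path_graph)
  next
    case (Suc i)
    then show ?case using arc[of i] by (auto intro: reachable_trans)
  qed
  have "i \<rightarrow>\<^sup>*\<^bsub>path_graph n\<^esub> j" if "i < n" "j < n" for i j
    using fwd[OF that(1)] fwd[OF that(2)]
    by (meson reachable_trans symmetric_reachable')
  then show ?thesis
    using assms unfolding connected_def
    by (intro strongly_connectedI)
      (auto intro: reachable_mk_symmetricI simp: verts_path_graph)
qed

lemma graph_dist_path_graph:
  assumes "i < n" "j < n"
  shows "graph_dist (path_graph n) i j = ereal \<bar>real i - real j\<bar>"
proof -
  interpret pair_graph "path_graph n" by (rule pair_graph_path_graph)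
  have cost: "awalk_cost (\<lambda>_. 1) p = real (length p)" for p :: "(nat \<times> nat) list"
    by (induction p) auto
  have lower: "\<bar>real u - real v\<bar> \<le> real (length p)" if "awalk u p v" for u p v
    using that
  proof (induction p arbitrary: u)
    case Nil
    then show ?case by (simp add: awalk_Nil_iff)
  next
    case (Cons e p)
    then have e: "e \<in> parcs (path_graph n)" "u = fst e" and p: "awalk (snd e) p v"
      by (auto simp: awalk_Cons_iff)
    from e have "\<bar>real u - real (snd e)\<bar> \<le> 1"
      by (cases e) (auto simp: arcs_path_graph)
    with Cons.IH[OF p] show ?case by simp
  qed
  have up: "\<exists>p. awalk u p (u + d) \<and> length p = d" if "u + d < n" for u d
    using that
  proof (induction d arbitrary: u)
    case 0
    then show ?case by (auto simp: awalk_Nil_iff verts_path_graph)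
  next
    case (Suc d)
    obtain p where "awalk (Suc u) p (Suc u + d)" "length p = d"
      using Suc.IH[of "Suc u"] Suc.prems by auto
    with Suc.prems show ?case
      by (intro exI[of _ "(u, Suc u) # p"]) (auto simp: awalk_Cons_iff arcs_path_graph)
  qed
  have down: "\<exists>p. awalk (u + d) p u \<and> length p = d" if "u + d < n" for u d
    using that
  proof (induction d)
    case 0
    then show ?case by (auto simp: awalk_Nil_iff verts_path_graph)
  next
    case (Suc d)
    then obtain p where "awalk (u + d) p u" "length p = d" by auto
    with Suc.prems show ?case
      by (intro exI[of _ "(Suc (u + d), u + d) # p"]) (auto simp: awalk_Cons_iff arcs_path_graph)
  qed
  obtain p where p: "awalk i p j" "real (length p) = \<bar>real i - real j\<bar>"
  proof (cases "i \<le> j")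
    case True
    then show thesis using up[of i "j - i"] assms that by (auto simp: of_nat_diff)
  next
    case False
    then show thesis using down[of j "i - j"] assms that by (auto simp: of_nat_diff)
  qed
  show ?thesis
    unfolding graph_dist_def \<mu>_def cost
  proof (rule antisym)
    show "(INF p\<in>{p. awalk i p j}. ereal (real (length p))) \<le> ereal \<bar>real i - real j\<bar>"
      using p by (intro INF_lower2[of p]) auto
    show "ereal \<bar>real i - real j\<bar> \<le> (INF p\<in>{p. awalk i p j}. ereal (real (length p)))"
      using lower by (intro INF_greatest) auto
  qed
qed

end

theory Submission
  imports Defs
begin

text \<open>
  Write \<open>s = 2t - r\<close>. For the upper bound, towers at \<open>t - r + i s\<close> (the last one moved back
  to the end of the path) suffice, since two towers at distance \<open>s\<close> jointly give \<open>2t - s = r\<close>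
  to every vertex between them.

  For the lower bound, work on the integers: if \<open>k\<close> towers give signal at least \<open>r\<close> on
  \<open>[a, b)\<close>, then \<open>b - a \<le> k s - (r - 1)\<close>, by induction on \<open>k\<close>. Suppose the towers \<open>A\<close> up to
  some tower \<open>c\<close>, not the last one, cover everything before \<open>c\<close>, and let \<open>p \<ge> c\<close> be the first
  vertex not covered by \<open>A\<close> alone. No tower of \<open>A\<close> reaches \<open>p + r - 1\<close> or beyond, so the
  remaining towers cover \<open>[p + r - 1, b)\<close>, and the two induction hypotheses add up to the claim.
  If there is no such \<open>c\<close>, then all towers are so close together that the last one reaches \<open>a\<close>,
  and the bound follows directly.
\<close>

section \<open>Signals on the integer line\<close>

definition line_signal :: "int \<Rightarrow> int set \<Rightarrow> int \<Rightarrow> int" where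
  "line_signal t T v = (\<Sum>x\<in>T. max 0 (t - \<bar>v - x\<bar>))"

lemma line_signal_Un:
  "finite A \<Longrightarrow> finite B \<Longrightarrow> A \<inter> B = {} \<Longrightarrow>
    line_signal t (A \<union> B) v = line_signal t A v + line_signal t B v"
  unfolding line_signal_def by (rule sum.union_disjoint)

lemma line_signal_singleton: "line_signal t {x} v = max 0 (t - \<bar>v - x\<bar>)"
  by (simp add: line_signal_def)

lemma line_signal_pair:
  "x \<noteq> y \<Longrightarrow> line_signal t {x, y} v = max 0 (t - \<bar>v - x\<bar>) + max 0 (t - \<bar>v - y\<bar>)"
  by (simp add: line_signal_def)

lemma line_signal_mono:
  "finite T \<Longrightarrow> S \<subseteq> T \<Longrightarrow> line_signal t S v \<le> line_signal t T v"
  unfolding line_signal_def by (rule sum_mono2) auto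

lemma line_signal_ge_tower:
  assumes "finite T" "x \<in> T"
  shows "t - \<bar>v - x\<bar> \<le> line_signal t T v"
  using line_signal_mono[of T "{x}" t v] assms by (simp add: line_signal_singleton)

lemma line_signal_ge_two_towers:
  assumes "finite T" "x \<in> T" "y \<in> T" "x \<noteq> y"
  shows "2 * t - \<bar>v - x\<bar> - \<bar>v - y\<bar> \<le> line_signal t T v"
  using line_signal_mono[of T "{x, y}" t v] assms by (simp add: line_signal_pair)

lemma line_signal_pos_imp_reached:
  assumes "0 < line_signal t T v"
  obtains x where "x \<in> T" "\<bar>v - x\<bar> < t"
proof -
  have "\<exists>x\<in>T. max 0 (t - \<bar>v - x\<bar>) > 0"
    using assms unfolding line_signal_def by (meson sum_nonpos not_le)
  then show thesis using that by auto
qed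

lemma line_signal_mono_left_of_towers:
  assumes "\<And>x. x \<in> T \<Longrightarrow> v \<le> x" "u \<le> v"
  shows "line_signal t T u \<le> line_signal t T v"
  unfolding line_signal_def using assms by (intro sum_mono) force

section \<open>Lower bound on the integer line\<close>

lemma first_deficient_vertex:
  fixes a b r :: int
  assumes "a \<le> b"
  obtains p where "a \<le> p" "p \<le> b" "\<And>v. a \<le> v \<Longrightarrow> v < p \<Longrightarrow> r \<le> h v" "p < b \<Longrightarrow> h p < r"
proof -
  have "\<exists>p. a \<le> p \<and> p \<le> b \<and> (\<forall>v. a \<le> v \<and> v < p \<longrightarrow> r \<le> h v) \<and> (p < b \<longrightarrow> h p < r)"
    using assms
  proof (induction b rule: int_ge_induct)
    case base
    then show ?case by (intro exI[of _ a]) auto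
  next
    case (step b)
    then obtain p where p: "a \<le> p" "p \<le> b" "\<forall>v. a \<le> v \<and> v < p \<longrightarrow> r \<le> h v" "p < b \<longrightarrow> h p < r"
      by auto
    show ?case
    proof (cases "p = b \<and> r \<le> h b")
      case True
      then have "\<forall>v. a \<le> v \<and> v < b + 1 \<longrightarrow> r \<le> h v"
        using p by (metis zle_add1_eq_le le_less)
      then show ?thesis using p by (intro exI[of _ "b + 1"]) auto
    next
      case False
      then show ?thesis using p by (intro exI[of _ p]) auto
    qed
  qed
  then show thesis using that by blast
qed

text \<open>\<open>bad\<close> says that no tower other than the last can serve as the splitting
  point of the induction. It forces neighbouring towers close together, so a vertex between two of
  them could not be short of signal without the last tower. Hence a vertex that needs the last tower
  lies left of all towers, and \<open>a\<close> needs it too.\<close>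

lemma last_tower_reaches_start:
  fixes t r a b :: int
  assumes fin: "finite T" and two: "2 \<le> card T" and rt: "r \<le> t" "1 \<le> r" and ab: "a < b"
    and dom: "\<And>v. a \<le> v \<Longrightarrow> v < b \<Longrightarrow> r \<le> line_signal t T v"
    and bad: "\<And>y. y \<in> T \<Longrightarrow> y \<noteq> Max T \<Longrightarrow>
      \<exists>v. a \<le> v \<and> v < y \<and> v < b \<and> line_signal t {x\<in>T. x \<le> y} v < r"
  shows "Max T - a < t \<and> (\<forall>x\<in>T. a < x)"
proof -
  define M where "M = Max T"
  define A where "A = T - {M}"
  have T0: "T \<noteq> {}" using two by auto
  have MT: "M \<in> T" and leM: "\<And>x. x \<in> T \<Longrightarrow> x \<le> M" using T0 fin by (auto simp: M_def)
  have finA: "finite A" using fin by (simp add: A_def)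
  have "card A = card T - 1" using fin MT by (simp add: A_def)
  then have A0: "A \<noteq> {}" using two by auto
  define c where "c = Max A"
  have cA: "c \<in> A" and lec: "\<And>x. x \<in> A \<Longrightarrow> x \<le> c" using A0 finA by (auto simp: c_def)
  have cM: "c < M" using cA leM by (auto simp: A_def order.strict_iff_order)
  have "{x\<in>T. x \<le> c} = A" using lec cM by (auto simp: A_def)
  \<comment> \<open>\<open>c\<close> is the second largest tower, so \<open>bad\<close> for
    \<open>c\<close> says that all towers but \<open>M\<close> together fail at some
    \<open>v\<close>.\<close>
  then obtain v where v: "a \<le> v" "v < c" "v < b" "line_signal t A v < r"
    using bad[of c] cA by (auto simp: A_def M_def)
  have reach: "\<bar>u - M\<bar> < t" if "a \<le> u" "u < b" "line_signal t A u < r" for u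
  proof -
    have "line_signal t T u = line_signal t A u + line_signal t {M} u"
      using line_signal_Un[of A "{M}" t u] MT finA by (simp add: A_def insert_absorb)
    then have "0 < line_signal t {M} u" using dom[OF that(1,2)] that(3) by linarith
    then show ?thesis by (auto simp: line_signal_singleton split: if_splits)
  qed
  have left: "v < x" if x: "x \<in> T" for x
  proof (rule ccontr)
    assume "\<not> v < x"
    define y where "y = Max {x\<in>T. x \<le> v}"
    define z where "z = Min {x\<in>T. v < x}"
    have "{x\<in>T. x \<le> v} \<noteq> {}" using x \<open>\<not> v < x\<close> by auto
    then have "y \<in> {x\<in>T. x \<le> v}"
      using fin unfolding y_def by (intro Max_in) auto
    then have y: "y \<in> T" "y \<le> v" by auto
    have yg: "\<And>x. x \<in> T \<Longrightarrow> x \<le> v \<Longrightarrow> x \<le> y" using fin by (simp add: y_def)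
    have cin: "c \<in> {x\<in>T. v < x}" using cA v by (auto simp: A_def)
    then have "z \<in> {x\<in>T. v < x}"
      using fin unfolding z_def by (intro Min_in) auto
    then have z: "z \<in> T" "v < z" by auto
    have zl: "\<And>x. x \<in> T \<Longrightarrow> v < x \<Longrightarrow> z \<le> x" using fin by (simp add: z_def)
    have zc: "z \<le> c" using zl cin by auto
    then have AA: "y \<in> A" "z \<in> A" using y z v cM by (auto simp: A_def)
    \<comment> \<open>\<open>bad\<close> for \<open>y\<close> gives a vertex left of
      \<open>y\<close> that needs a tower beyond \<open>y\<close>. The nearest such tower is
      \<open>z\<close>, so \<open>z - y < t\<close>. Then \<open>y\<close> and \<open>z\<close>
      jointly give \<open>v\<close> the signal 2t - (z - y) > t >= r without \<open>M\<close>,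
      contradicting the choice of \<open>v\<close>.\<close>
    obtain w where w: "a \<le> w" "w < y" "w < b" "line_signal t {x\<in>T. x \<le> y} w < r"
      using bad[of y] AA by (auto simp: A_def M_def)
    have "{x\<in>T. x \<le> y} \<union> {x\<in>T. y < x} = T" by auto
    then have "line_signal t T w =
        line_signal t {x\<in>T. x \<le> y} w + line_signal t {x\<in>T. y < x} w"
      using line_signal_Un[of "{x\<in>T. x \<le> y}" "{x\<in>T. y < x}" t w] fin by fastforce
    then have "0 < line_signal t {x\<in>T. y < x} w" using dom[OF w(1,3)] w(4) by linarith
    then obtain x' where x': "x' \<in> {x\<in>T. y < x}" "\<bar>w - x'\<bar> < t"
      by (rule line_signal_pos_imp_reached)
    then have "z \<le> x'" using yg zl by force
    then have "z - y < t" using x' w by auto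
    moreover have "2 * t - \<bar>v - y\<bar> - \<bar>v - z\<bar> \<le> line_signal t A v"
      using y z by (intro line_signal_ge_two_towers[OF finA AA]) auto
    ultimately show False using v y z rt by linarith
  qed
  \<comment> \<open>Going left from \<open>v\<close> to \<open>a\<close> moves away from every
    tower, so \<open>A\<close> fails at \<open>a\<close> as well.\<close>
  have "line_signal t A a \<le> line_signal t A v"
    using left v by (intro line_signal_mono_left_of_towers) (auto simp: A_def less_imp_le)
  then have "\<bar>a - M\<bar> < t" using reach[of a] ab v by auto
  moreover have "\<forall>x\<in>T. a < x" using left v by force
  ultimately show ?thesis by (auto simp: M_def)
qed

text \<open>All towers are within reach of \<open>a\<close>, so the interval has at most 2t - 1
  vertices. This suffices for three or more towers; for two towers and \<open>r\<close> close to
  \<open>t\<close> it does not, and the exact signals at both ends are needed.\<close>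

lemma clustered_towers_bound:
  fixes t r a b :: int
  assumes fin: "finite T" and two: "2 \<le> card T" and rt: "r \<le> t" "1 \<le> r" and ab: "a < b"
    and dom: "\<And>v. a \<le> v \<Longrightarrow> v < b \<Longrightarrow> r \<le> line_signal t T v"
    and start: "Max T - a < t" "\<And>x. x \<in> T \<Longrightarrow> a < x"
  shows "b - a \<le> int (card T) * (2 * t - r) - (r - 1)"
proof -
  have leM: "\<And>x. x \<in> T \<Longrightarrow> x \<le> Max T" using fin by simp
  have ra: "r \<le> line_signal t T a" and rb: "r \<le> line_signal t T (b - 1)"
    using dom ab by auto
  obtain x where x: "x \<in> T" "\<bar>b - 1 - x\<bar> < t"
    using rb rt by (auto intro: line_signal_pos_imp_reached[of t T "b - 1"])
  then have far: "b - 1 - a \<le> 2 * t - 2" using leM[OF x(1)] start by auto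
  show ?thesis
  proof (cases "card T = 2")
    case True
    then obtain x y where xy: "T = {x, y}" "x \<noteq> y" by (auto simp: card_2_iff)
    \<comment> \<open>Both towers reach \<open>a\<close>. If both reach \<open>b - 1\<close>, add
      the two signal inequalities and use the triangle inequality for each tower. If only one does,
      it is within t - r of \<open>b - 1\<close> and less than t from \<open>a\<close>.\<close>
    have "b - 1 - a \<le> 2 * t - r"
      using ra rb start(2)[of x] start(2)[of y] leM[of x] leM[of y] start(1) rt xy
      by (auto simp: line_signal_pair)
    with True rt show ?thesis by simp
  next
    case False
    then have "3 * (2 * t - r) \<le> int (card T) * (2 * t - r)"
      using two rt by (intro mult_right_mono) auto
    moreover have "b - a \<le> 3 * (2 * t - r) - (r - 1)" using far rt by simp
    ultimately show ?thesis by (meson diff_right_mono order_trans)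
  qed
qed

text \<open>Towers may lie outside [a, b): the split below may leave \<open>B\<close> with towers
  left of the interval it has to cover.\<close>

lemma covered_interval_bound:
  fixes t r a b :: int
  assumes "finite T" "T \<noteq> {}" and rt: "r \<le> t" "1 \<le> r"
    and "\<And>v. a \<le> v \<Longrightarrow> v < b \<Longrightarrow> r \<le> line_signal t T v"
  shows "b - a \<le> int (card T) * (2 * t - r) - (r - 1)"
  using assms(1,2,5)
proof (induction "card T" arbitrary: T a b rule: less_induct)
  case less
  note fin = less.prems(1) and dom = less.prems(3)
  have pos: "1 \<le> card T" using less.prems by (simp add: Suc_le_eq card_gt_0_iff)
  have nn: "1 * (2 * t - r) \<le> int (card T) * (2 * t - r)"
    using pos rt by (intro mult_right_mono) auto
  consider "b \<le> a" | "a < b" "card T = 1" | "a < b" "2 \<le> card T"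
    using pos by linarith
  then show ?case
  proof cases
    \<comment> \<open>Empty intervals do arise in the induction; for them 2t - r >= r - 1 is
      enough.\<close>
    case 1
    then have "b - a \<le> 1 * (2 * t - r) - (r - 1)" using rt by simp
    then show ?thesis using nn by (meson diff_right_mono order_trans)
  next
    case 2
    then obtain x where "T = {x}" by (auto simp: card_1_singleton_iff)
    then have "r \<le> max 0 (t - \<bar>a - x\<bar>)" "r \<le> max 0 (t - \<bar>b - 1 - x\<bar>)"
      using dom[of a] dom[of "b - 1"] 2 by (auto simp: line_signal_singleton)
    with 2 rt show ?thesis by auto
  next
    case 3
    show ?thesis
    proof (cases "\<exists>c\<in>T. c \<noteq> Max T \<and>
        (\<forall>v. a \<le> v \<and> v < c \<and> v < b \<longrightarrow> r \<le> line_signal t {x\<in>T. x \<le> c} v)")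
      case True
      then obtain c where c: "c \<in> T" "c \<noteq> Max T"
        and cov: "\<And>v. a \<le> v \<Longrightarrow> v < c \<Longrightarrow> v < b \<Longrightarrow> r \<le> line_signal t {x\<in>T. x \<le> c} v"
        by blast
      define A where "A = {x\<in>T. x \<le> c}"
      define B where "B = {x\<in>T. c < x}"
      have fAB: "finite A" "finite B" and dAB: "A \<inter> B = {}" and uAB: "A \<union> B = T"
        using fin by (auto simp: A_def B_def)
      have "Max T \<in> B"
        using c Max_ge[OF fin c(1)] Max_in[OF fin less.prems(2)] by (auto simp: B_def)
      then have AB0: "A \<noteq> {}" "B \<noteq> {}" using c by (auto simp: A_def)
      have cT: "card T = card A + card B"
        using card_Un_disjoint[OF fAB dAB] uAB by simp
      then have smaller: "card A < card T" "card B < card T"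
        using fAB AB0 by (auto simp: card_gt_0_iff)
      \<comment> \<open>If \<open>A\<close> covers everything, then \<open>p = b\<close> and nothing
        remains for \<open>B\<close> to cover.\<close>
      obtain p where p: "a \<le> p" "p \<le> b" "\<And>v. a \<le> v \<Longrightarrow> v < p \<Longrightarrow> r \<le> line_signal t A v"
        "p < b \<Longrightarrow> line_signal t A p < r"
        using first_deficient_vertex[of a b r "line_signal t A"] 3 by auto
      have A_bound: "p - a \<le> int (card A) * (2 * t - r) - (r - 1)"
        using less.hyps[OF smaller(1) fAB(1) AB0(1)] p(3) by blast
      have "b - (p + r - 1) \<le> int (card B) * (2 * t - r) - (r - 1)"
      proof (rule less.hyps[OF smaller(2) fAB(2) AB0(2)])
        fix v assume v: "p + r - 1 \<le> v" "v < b"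
        then have pb: "p < b" using rt by linarith
        then have cp: "c \<le> p" using cov[of p] p by (force simp: A_def)
        \<comment> \<open>A single tower of \<open>A\<close> gives at most r - 1 at \<open>p\<close>
          and lies at or left of \<open>p\<close>. Its signal drops by one per step to the right, so
          it is gone after r - 1 steps.\<close>
        have "max 0 (t - \<bar>v - x\<bar>) = 0" if "x \<in> A" for x
        proof -
          have "t - \<bar>p - x\<bar> < r"
            using line_signal_ge_tower[OF fAB(1) that, of t p] p(4)[OF pb] by linarith
          moreover have "x \<le> p" using that cp by (auto simp: A_def)
          ultimately show ?thesis using v by linarith
        qed
        then have "line_signal t A v = 0" by (simp add: line_signal_def)
        then show "r \<le> line_signal t B v"
          using line_signal_Un[OF fAB dAB, of t v] uAB dom[of v] v p(1) rt by auto
      qed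
      \<comment> \<open>The gap of r - 1 between the two intervals offsets one of the two subtracted
        terms r - 1.\<close>
      with A_bound cT show ?thesis by (simp add: algebra_simps)
    next
      case False
      then have "Max T - a < t \<and> (\<forall>x\<in>T. a < x)"
        using fin 3 rt dom
        by (intro last_tower_reaches_start[where b = b and r = r]) (auto simp: not_le)
      then show ?thesis
        using clustered_towers_bound[OF fin 3(2) rt 3(1) dom] by blast
    qed
  qed
qed

section \<open>Transfer to the path graph\<close>

lemma signal_path_graph:
  assumes "T \<subseteq> {0..<n}" "v < n"
  shows "signal (path_graph n) t T v = ereal (of_int (line_signal (int t) (int ` T) (int v)))"
proof -
  have "max 0 (ereal (real t) - graph_dist (path_graph n) v w) =
      ereal (of_int (max 0 (int t - \<bar>int v - int w\<bar>)))" if "w \<in> T" for w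
  proof -
    have "w < n" using that assms by auto
    then have "ereal (real t) - graph_dist (path_graph n) v w =
        ereal (of_int (int t - \<bar>int v - int w\<bar>))"
      using assms by (simp add: graph_dist_path_graph)
    moreover have "max 0 (ereal (of_int d)) = ereal (of_int (max 0 d))" for d :: int
      by (cases "0 \<le> d") (auto simp: max_def)
    ultimately show ?thesis by (simp only:)
  qed
  then show ?thesis
    unfolding signal_def line_signal_def by (simp add: sum.reindex)
qed

lemma broadcast_dominating_path_graph:
  "broadcast_dominating (path_graph n) t r T \<longleftrightarrow>
    T \<subseteq> {0..<n} \<and> (\<forall>v<n. int r \<le> line_signal (int t) (int ` T) (int v))"
proof -
  have "ereal (real r) \<le> ereal (of_int k) \<longleftrightarrow> int r \<le> k" for k
    by (metis ereal_less_eq(3) of_int_le_iff of_int_of_nat_eq)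
  then show ?thesis
    unfolding broadcast_dominating_def
    by (auto simp: verts_path_graph signal_path_graph)
qed

lemma broadcast_dominating_path_graph_card_ge:
  assumes "broadcast_dominating (path_graph n) t r T" "n \<ge> 1" "t \<ge> r" "r \<ge> 1"
  shows "int n + (int r - 1) \<le> int (card T) * (2 * int t - int r)"
proof -
  have T: "T \<subseteq> {0..<n}" and dom: "\<And>v. v < n \<Longrightarrow> int r \<le> line_signal (int t) (int ` T) (int v)"
    using assms(1) by (auto simp: broadcast_dominating_path_graph)
  have "T \<noteq> {}" using dom[of 0] assms by (auto simp: line_signal_def)
  moreover have "finite T" using T finite_subset by blast
  moreover have "int r \<le> line_signal (int t) (int ` T) v" if "0 \<le> v" "v < int n" for v
    using dom[of "nat v"] that by auto
  ultimately have "int n - 0 \<le> int (card (int ` T)) * (2 * int t - int r) - (int r - 1)"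
    using assms by (intro covered_interval_bound) auto
  then show ?thesis by (simp add: card_image)
qed

section \<open>Upper bound by explicit towers\<close>

lemma ex_broadcast_dominating_path_graph:
  assumes "n + (r - 1) \<le> k * (2 * t - r)" "n \<ge> 1" "t \<ge> r" "r \<ge> 1"
  shows "\<exists>T. broadcast_dominating (path_graph n) t r T \<and> card T \<le> k"
proof -
  define s where "s = 2 * t - r"
  \<comment> \<open>A tower at t - r gives exactly r at vertex 0. The \<open>min\<close> can merge
    several towers at the end of the path, so only \<open>card T \<le> k\<close> is claimed.\<close>
  define x where "x i = min (n - 1) (t - r + i * s)" for i
  define T where "T = x ` {..<k}"
  have s: "int s = 2 * int t - int r" "s > 0" using assms by (auto simp: s_def of_nat_diff)
  have nk: "int n + int r - 1 \<le> int k * int s"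
  proof -
    have "int (n + (r - 1)) \<le> int (k * s)"
      using assms(1) unfolding s_def by (simp only: of_nat_le_iff)
    then show ?thesis using assms by simp
  qed
  have k0: "k > 0" using assms by (cases k) auto
  have finT: "finite (int ` T)" by (simp add: T_def)
  have in_T: "int (x i) \<in> int ` T" if "i < k" for i using that by (auto simp: T_def)
  have "int r \<le> line_signal (int t) (int ` T) (int v)" if v: "v < n" for v
  proof -
    have one: ?thesis if "i < k" "\<bar>int v - int (x i)\<bar> \<le> int t - int r" for i
      using line_signal_ge_tower[OF finT in_T[OF that(1)], of "int t" "int v"] that by linarith
    show ?thesis
    proof (cases "v \<le> t - r")
      case True
      then show ?thesis using v assms k0 by (intro one[of 0]) (auto simp: x_def)
    next
      case False
      \<comment> \<open>\<open>y\<close> is the last of the positions t - r + i s at or before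
        \<open>v\<close>; since \<open>y \<le> v < n\<close>, the \<open>min\<close> does not move
        it.\<close>
      define j where "j = (v - (t - r)) div s"
      define y where "y = t - r + j * s"
      have split: "v - (t - r) = j * s + (v - (t - r)) mod s" by (simp add: j_def)
      have "(v - (t - r)) mod s < s" using s by simp
      then have yv: "y \<le> v" "v < y + s" using split False by (auto simp: y_def)
      have xj: "x j = y" using yv v by (auto simp: x_def y_def)
      have yint: "int y = int t - int r + int j * int s"
        using assms by (simp add: y_def of_nat_diff)
      have "int j * int s < int k * int s"
        using yv(1) v nk yint assms by linarith
      then have jk: "j < k" using s by simp
      show ?thesis
      proof (cases "Suc j < k")
        case True
        define z where "z = x (Suc j)"
        have z: "v \<le> z" "z \<le> y + s" using yv v by (auto simp: z_def x_def y_def)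
        show ?thesis
        proof (cases "z = y")
          case True
          \<comment> \<open>As s > 0, the two towers coincide only at the end of the path, and then
            \<open>v = y\<close>.\<close>
          then show ?thesis using z yv xj jk assms by (intro one[of j]) auto
        next
          case False
          then have "2 * int t - \<bar>int v - int y\<bar> - \<bar>int v - int z\<bar> \<le>
              line_signal (int t) (int ` T) (int v)"
            using in_T[OF jk] in_T[OF True] xj
            by (intro line_signal_ge_two_towers[OF finT]) (auto simp: z_def)
          then show ?thesis using z yv s by linarith
        qed
      next
        case False
        then have "k = Suc j" using jk by simp
        \<comment> \<open>From v <= n - 1 <= k s - r and y = t - r + (k - 1) s follows v - y <= s -
          t = t - r, so the last tower suffices alone.\<close>
        then have "int v - int y \<le> int t - int r"
          using nk yint v s by (simp add: algebra_simps)
        then show ?thesis using yv xj jk by (intro one[of j]) auto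
      qed
    qed
  qed
  moreover have "T \<subseteq> {0..<n}" using assms by (auto simp: T_def x_def)
  moreover have "card T \<le> k" using card_image_le[of "{..<k}" x] by (simp add: T_def)
  ultimately show ?thesis by (auto simp: broadcast_dominating_path_graph)
qed

section \<open>The ceiling formula\<close>

theorem theorem1p1:
  fixes n t r :: nat
  assumes "n \<ge> 1" and "t \<ge> r" and "r \<ge> 1"
  shows "int (broadcast_domination_number (path_graph n) t r) =
    \<lceil>(real n + (real r - 1)) / (2 * real t - real r)\<rceil>"
proof -
  define q where "q = (real n + (real r - 1)) / (2 * real t - real r)"
  define k where "k = nat \<lceil>q\<rceil>"
  have spos: "0 < 2 * real t - real r" using assms by simp
  have "0 \<le> q" using assms by (auto simp: q_def)
  then have k: "int k = \<lceil>q\<rceil>" by (simp add: k_def)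
  then have "q \<le> real k" by linarith
  then have "real n + (real r - 1) \<le> real k * (2 * real t - real r)"
    using spos by (simp add: q_def pos_divide_le_eq)
  also have "\<dots> = real (k * (2 * t - r))" using assms by (simp add: of_nat_diff)
  finally have "n + (r - 1) \<le> k * (2 * t - r)"
    using assms by (metis of_nat_le_iff of_nat_add of_nat_diff of_nat_1)
  then obtain T where T: "broadcast_dominating (path_graph n) t r T" "card T \<le> k"
    using ex_broadcast_dominating_path_graph assms by blast
  have lower: "k \<le> card S" if "broadcast_dominating (path_graph n) t r S" for S
  proof -
    have "int n + (int r - 1) \<le> int (card S) * (2 * int t - int r)"
      using broadcast_dominating_path_graph_card_ge[OF that assms] .
    then have "real_of_int (int n + (int r - 1)) \<le>
        real_of_int (int (card S) * (2 * int t - int r))"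
      by (simp only: of_int_le_iff)
    then have "q \<le> real (card S)" using spos by (simp add: q_def pos_divide_le_eq)
    then show ?thesis using k by linarith
  qed
  have "broadcast_domination_number (path_graph n) t r = k"
    unfolding broadcast_domination_number_def
    using T lower by (intro Least_equality) (auto intro: le_antisym)
  then show ?thesis using k by (simp add: q_def)
qed

end
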